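(* Let $p$ be a prime, let $c,d\in\mathbb{Z}$ with $d\neq 0$, and let $H,l\in\mathbb{Z}_{\ge 1}$ with $|c|+|d|\le H$. Let $t\in\mathbb{Z}\setminus\{0\}$ with $|t|_p<1$. For $n\in\mathbb{Z}_{\ge1}$ put $$B(n,t)=\left(\frac{n|t|}{4}\right)^{1/4}+\left(\frac{n|t|}{4}\right)^{-1/4}.$$ Suppose that $$H\cdot 2\,(l+1)!\,B(l+1,t)\cdot |t|^{l+1}e^{2\sqrt{\frac{l+1}{|t|}}}\cdot |t|_p^{2l}<1.$$ Then $$\left|dE_p(t)-c\right|_p\ge |t|_p^{2l}.$$
   Context: $|\cdot|$ is the usual absolute value and $|\cdot|_p$ the $p$-adic absolute value normalized by $|p|_p=p^{-1}$. $E_p(z)$ denotes the $p$-adic sum $\sum_{n=0}^\infty n!z^n$, which converges in $\mathbb{C}_p$ for $|z|_p<p^{1/(p-1)}$ (in particular for $|z|_p<1$). *)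

theory Defs
  imports Complex_Main "HOL-Computational_Algebra.Primes" "HOL-Algebra.QuotRing"
begin

section \<open>The \<open>p\<close>-adic absolute value on the rationals\<close>

definition padic_val :: "nat \<Rightarrow> rat \<Rightarrow> int" where
  "padic_val p x = (case quotient_of x of (a, b) \<Rightarrow>
     int (multiplicity (int p) a) - int (multiplicity (int p) b))"

definition padic_abs :: "nat \<Rightarrow> rat \<Rightarrow> real" where
  "padic_abs p x = (if x = 0 then 0 else real p powi (- padic_val p x))"


section \<open>The field of \<open>p\<close>-adic numbers\<close>

text \<open>
  The field of \<open>p\<close>-adic numbers is the completion of the rationals for \<^const>\<open>padic_abs\<close>:
  the ring of Cauchy sequences modulo the ideal of null sequences.
\<close>

definition padic_cauchy :: "nat \<Rightarrow> (nat \<Rightarrow> rat) \<Rightarrow> bool" where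
  "padic_cauchy p X \<longleftrightarrow>
     (\<forall>e>0. \<exists>N. \<forall>m\<ge>N. \<forall>n\<ge>N. padic_abs p (X m - X n) < e)"

definition padic_cauchy_ring :: "nat \<Rightarrow> (nat \<Rightarrow> rat) ring" where
  "padic_cauchy_ring p =
     \<lparr>carrier = {X. padic_cauchy p X},
      monoid.mult = (\<lambda>X Y n. X n * Y n), one = (\<lambda>n. 1),
      zero = (\<lambda>n. 0), add = (\<lambda>X Y n. X n + Y n)\<rparr>"

definition padic_null :: "nat \<Rightarrow> (nat \<Rightarrow> rat) set" where
  "padic_null p = {X. (\<lambda>n. padic_abs p (X n)) \<longlonglongrightarrow> 0}"

definition padic_field :: "nat \<Rightarrow> (nat \<Rightarrow> rat) set ring" where
  "padic_field p = padic_cauchy_ring p Quot padic_null p"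

text \<open>The class of a Cauchy sequence, i.e. its limit in the completion.\<close>

definition padic_class :: "nat \<Rightarrow> (nat \<Rightarrow> rat) \<Rightarrow> (nat \<Rightarrow> rat) set" where
  "padic_class p X = padic_null p +>\<^bsub>padic_cauchy_ring p\<^esub> X"

definition padic_of_int :: "nat \<Rightarrow> int \<Rightarrow> (nat \<Rightarrow> rat) set" where
  "padic_of_int p k = padic_class p (\<lambda>n. of_int k)"

text \<open>
  The continuous extension of \<^const>\<open>padic_abs\<close> to the completion.
  All representatives \<open>X\<close> of a class give the same limit (\<open>padic_norm_class\<close> below).
\<close>

definition padic_norm :: "nat \<Rightarrow> (nat \<Rightarrow> rat) set \<Rightarrow> real" where
  "padic_norm p x = (THE r. \<forall>X\<in>x. (\<lambda>n. padic_abs p (X n)) \<longlonglongrightarrow> r)"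

definition padic_sums ::
    "nat \<Rightarrow> (nat \<Rightarrow> (nat \<Rightarrow> rat) set) \<Rightarrow> (nat \<Rightarrow> rat) set \<Rightarrow> bool" where
  "padic_sums p f s \<longleftrightarrow> s \<in> carrier (padic_field p) \<and>
     (\<lambda>N. padic_norm p ((\<Oplus>\<^bsub>padic_field p\<^esub>n\<in>{..<N}. f n) \<ominus>\<^bsub>padic_field p\<^esub> s))
       \<longlonglongrightarrow> 0"

definition padic_suminf ::
    "nat \<Rightarrow> (nat \<Rightarrow> (nat \<Rightarrow> rat) set) \<Rightarrow> (nat \<Rightarrow> rat) set" where
  "padic_suminf p f = (THE s. padic_sums p f s)"


section \<open>Euler's factorial series and the bound \<open>B\<close>\<close>

text \<open>
  Arguments are taken in the \<open>p\<close>-adic numbers rather than in the completion of their algebraic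
  closure: for rational arguments the partial sums are rational, so both give the same sum.
\<close>

definition E_p :: "nat \<Rightarrow> (nat \<Rightarrow> rat) set \<Rightarrow> (nat \<Rightarrow> rat) set" where
  "E_p p z = padic_suminf p (\<lambda>n.
     padic_of_int p (fact n) \<otimes>\<^bsub>padic_field p\<^esub> (z [^]\<^bsub>padic_field p\<^esub> n))"

definition B :: "nat \<Rightarrow> int \<Rightarrow> real" where
  "B n t = (real n * \<bar>real_of_int t\<bar> / 4) powr (1 / 4)
         + (real n * \<bar>real_of_int t\<bar> / 4) powr (- 1 / 4)"


section \<open>Well-definedness\<close>

lemma padic_abs_frac:
  assumes p: "prime p" and a: "a \<noteq> 0" and b: "b \<noteq> 0"
  shows "padic_abs p (of_int a / of_int b) =
    real p powi (int (multiplicity (int p) b) - int (multiplicity (int p) a))"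
proof -
  define x :: rat where "x = of_int a / of_int b"
  obtain u v where uv: "quotient_of x = (u, v)" by force
  have x: "x = of_int u / of_int v" and v: "v \<noteq> 0"
    using quotient_of_div[OF uv] quotient_of_denom_pos[OF uv] by auto
  have x0: "x \<noteq> 0" using a b by (simp add: x_def)
  have u: "u \<noteq> 0" using x x0 by auto
  have "(of_int (a * v) :: rat) = of_int (u * b)"
    using x b v by (simp add: x_def field_simps)
  then have eq: "a * v = u * b" by (simp only: of_int_eq_iff)
  have pe: "prime_elem (int p)" using p by auto
  have "multiplicity (int p) a + multiplicity (int p) v =
      multiplicity (int p) u + multiplicity (int p) b"
    using arg_cong[OF eq, of "multiplicity (int p)"]
    by (simp add: prime_elem_multiplicity_mult_distrib[OF pe] a b u v)
  then have "- padic_val p x =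
      int (multiplicity (int p) b) - int (multiplicity (int p) a)"
    unfolding padic_val_def uv by simp
  then show ?thesis using x0 unfolding padic_abs_def x_def by simp
qed

lemma padic_abs_0 [simp]: "padic_abs p 0 = 0"
  by (simp add: padic_abs_def)

lemma padic_abs_of_int:
  assumes "prime p" "k \<noteq> 0"
  shows "padic_abs p (of_int k) = 1 / real p ^ multiplicity (int p) k"
  using padic_abs_frac[OF assms(1) assms(2), of 1] assms
  by (simp add: power_int_minus field_simps)

lemma padic_abs_1 [simp]: "prime p \<Longrightarrow> padic_abs p 1 = 1"
  using padic_abs_of_int[of p 1] by simp

lemma padic_abs_p: "prime p \<Longrightarrow> padic_abs p (of_nat p) = 1 / real p"
  using padic_abs_of_int[of p "int p"] prime_gt_0_nat[of p]
  by (simp add: multiplicity_self prime_nat_iff)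

lemma padic_abs_nonneg [simp]: "padic_abs p x \<ge> 0"
  by (simp add: padic_abs_def)

lemma padic_abs_eq_0_iff: "prime p \<Longrightarrow> padic_abs p x = 0 \<longleftrightarrow> x = 0"
  by (auto simp: padic_abs_def)

lemma rat_frac: obtains a b :: int where "x = (of_int a / of_int b :: rat)" "b \<noteq> 0"
  using quotient_of_div[of x] quotient_of_denom_pos[of x] by (cases "quotient_of x") force

lemma padic_abs_mult:
  assumes p: "prime p"
  shows "padic_abs p (x * y) = padic_abs p x * padic_abs p y"
proof (cases "x = 0 \<or> y = 0")
  case False
  obtain a b where x: "x = of_int a / of_int b" "b \<noteq> 0" by (rule rat_frac)
  obtain c d where y: "y = of_int c / of_int d" "d \<noteq> 0" by (rule rat_frac)
  have ac: "a \<noteq> 0" "c \<noteq> 0" using False x y by auto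
  have pe: "prime_elem (int p)" using p by auto
  have p0: "real p \<noteq> 0" using p by auto
  have xy: "x * y = of_int (a * c) / of_int (b * d)" by (simp add: x y)
  show ?thesis
    unfolding xy unfolding x y
    using x(2) y(2) ac p0
    by (simp add: padic_abs_frac[OF p] prime_elem_multiplicity_mult_distrib[OF pe]
        flip: power_int_add of_int_mult) (simp add: algebra_simps)
qed auto

lemma padic_abs_minus [simp]: "prime p \<Longrightarrow> padic_abs p (- x) = padic_abs p x"
proof -
  assume p: "prime p"
  have "padic_abs p (-1) = 1"
    using padic_abs_of_int[OF p, of "-1"] multiplicity_unit_right[of "-1" "int p"] by simp
  then show ?thesis using padic_abs_mult[OF p, of "-1" x] by simp
qed

lemma padic_abs_add:
  assumes p: "prime p"
  shows "padic_abs p (x + y) \<le> max (padic_abs p x) (padic_abs p y)"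
proof (cases "x = 0 \<or> y = 0 \<or> x + y = 0")
  case True
  then show ?thesis by (auto simp: le_max_iff_disj)
next
  case False
  obtain a b where x: "x = of_int a / of_int b" "b \<noteq> 0" by (rule rat_frac)
  obtain c d where y: "y = of_int c / of_int d" "d \<noteq> 0" by (rule rat_frac)
  have pe: "prime_elem (int p)" using p by auto
  have p1: "real p \<ge> 1" using prime_ge_1_nat[OF p] by simp
  have x': "x = of_int (a * d) / of_int (b * d)"
    and y': "y = of_int (c * b) / of_int (b * d)"
    and xy: "x + y = of_int (a * d + c * b) / of_int (b * d)"
    using x y by (auto simp: field_simps)
  have nz: "a * d \<noteq> 0" "c * b \<noteq> 0" "a * d + c * b \<noteq> 0" "b * d \<noteq> 0"
    using False x' y' xy x(2) y(2) by (auto simp del: of_int_add of_int_mult)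
  let ?m = "multiplicity (int p)"
  have nu: "\<not> is_unit (int p)" using pe by (rule prime_elem_not_unit)
  have "int p ^ min (?m (a * d)) (?m (c * b)) dvd a * d + c * b"
    by (intro dvd_add) (auto intro: dvd_trans[OF le_imp_power_dvd multiplicity_dvd])
  then have "min (?m (a * d)) (?m (c * b)) \<le> ?m (a * d + c * b)"
    using nz(3) nu by (intro multiplicity_geI)
  then have "?m (a * d) \<le> ?m (a * d + c * b) \<or> ?m (c * b) \<le> ?m (a * d + c * b)"
    by linarith
  then show ?thesis
    unfolding xy unfolding x' y' le_max_iff_disj
    using nz p1 by (simp only: padic_abs_frac[OF p] not_False_eq_True)
      (auto intro!: power_int_increasing)
qed

lemma padic_abs_add_le:
  assumes "prime p"
  shows "padic_abs p (x + y) \<le> padic_abs p x + padic_abs p y"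
  using padic_abs_add[OF assms, of x y] padic_abs_nonneg[of p x] padic_abs_nonneg[of p y]
  by linarith

lemma padic_abs_diff_le:
  assumes "prime p"
  shows "\<bar>padic_abs p x - padic_abs p y\<bar> \<le> padic_abs p (x - y)"
  using padic_abs_add_le[OF assms, of "x - y" y] padic_abs_add_le[OF assms, of "y - x" x]
    padic_abs_minus[OF assms, of "x - y"] by simp

lemma padic_cauchy_const [simp]: "padic_cauchy p (\<lambda>n. c)"
  by (simp add: padic_cauchy_def)

lemma padic_cauchy_add:
  assumes p: "prime p" and X: "padic_cauchy p X" and Y: "padic_cauchy p Y"
  shows "padic_cauchy p (\<lambda>n. X n + Y n)"
  unfolding padic_cauchy_def
proof (intro allI impI)
  fix e :: real assume "e > 0"
  then obtain M N where
    M: "\<And>m n. m \<ge> M \<Longrightarrow> n \<ge> M \<Longrightarrow> padic_abs p (X m - X n) < e" and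
    N: "\<And>m n. m \<ge> N \<Longrightarrow> n \<ge> N \<Longrightarrow> padic_abs p (Y m - Y n) < e"
    using X Y unfolding padic_cauchy_def by meson
  have "padic_abs p (X m + Y m - (X n + Y n)) < e" if "m \<ge> max M N" "n \<ge> max M N" for m n
    using padic_abs_add[OF p, of "X m - X n" "Y m - Y n"] M[of m n] N[of m n] that
    by (simp add: algebra_simps)
  then show "\<exists>N. \<forall>m\<ge>N. \<forall>n\<ge>N. padic_abs p (X m + Y m - (X n + Y n)) < e" by blast
qed

lemma padic_cauchy_minus:
  assumes p: "prime p" and X: "padic_cauchy p X"
  shows "padic_cauchy p (\<lambda>n. - X n)"
proof -
  have "- X m - - X n = - (X m - X n)" for m n by simp
  then show ?thesis using X unfolding padic_cauchy_def by (simp only: padic_abs_minus[OF p])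
qed

lemma padic_cauchy_convergent:
  assumes p: "prime p" and X: "padic_cauchy p X"
  shows "convergent (\<lambda>n. padic_abs p (X n))"
proof (rule Cauchy_convergent, rule metric_CauchyI)
  fix e :: real assume "e > 0"
  then obtain N where N: "\<And>m n. m \<ge> N \<Longrightarrow> n \<ge> N \<Longrightarrow> padic_abs p (X m - X n) < e"
    using X unfolding padic_cauchy_def by meson
  have "dist (padic_abs p (X m)) (padic_abs p (X n)) < e" if "m \<ge> N" "n \<ge> N" for m n
    using N[OF that] padic_abs_diff_le[OF p, of "X m" "X n"] by (simp add: dist_real_def)
  then show "\<exists>N. \<forall>m\<ge>N. \<forall>n\<ge>N. dist (padic_abs p (X m)) (padic_abs p (X n)) < e" by blast
qed

lemma padic_cauchy_bounded:
  assumes p: "prime p" and X: "padic_cauchy p X"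
  obtains K where "K > 0" "\<And>n. padic_abs p (X n) \<le> K"
proof -
  have "Bseq (\<lambda>n. padic_abs p (X n))"
    using padic_cauchy_convergent[OF p X] by (rule convergent_imp_Bseq)
  then show ?thesis using that by (auto elim!: BseqE)
qed

lemma padic_cauchy_mult:
  assumes p: "prime p" and X: "padic_cauchy p X" and Y: "padic_cauchy p Y"
  shows "padic_cauchy p (\<lambda>n. X n * Y n)"
  unfolding padic_cauchy_def
proof (intro allI impI)
  fix e :: real assume e: "e > 0"
  obtain K where K: "K > 0" "\<And>n. padic_abs p (X n) \<le> K"
    using padic_cauchy_bounded[OF p X] by blast
  obtain L where L: "L > 0" "\<And>n. padic_abs p (Y n) \<le> L"
    using padic_cauchy_bounded[OF p Y] by blast
  obtain M where M: "\<And>m n. m \<ge> M \<Longrightarrow> n \<ge> M \<Longrightarrow> padic_abs p (X m - X n) < e / L"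
    using X e L(1) unfolding padic_cauchy_def by (meson divide_pos_pos)
  obtain N where N: "\<And>m n. m \<ge> N \<Longrightarrow> n \<ge> N \<Longrightarrow> padic_abs p (Y m - Y n) < e / K"
    using Y e K(1) unfolding padic_cauchy_def by (meson divide_pos_pos)
  have "padic_abs p (X m * Y m - X n * Y n) < e" if mn: "m \<ge> max M N" "n \<ge> max M N" for m n
  proof -
    have "padic_abs p (X m) * padic_abs p (Y m - Y n) \<le> K * padic_abs p (Y m - Y n)"
      using K by (intro mult_right_mono) auto
    also have "\<dots> < e" using N[of m n] mn K(1) by (simp add: field_simps)
    finally have 1: "padic_abs p (X m) * padic_abs p (Y m - Y n) < e" .
    have "padic_abs p (X m - X n) * padic_abs p (Y n) \<le> padic_abs p (X m - X n) * L"
      using L by (intro mult_left_mono) auto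
    also have "\<dots> < e" using M[of m n] mn L(1) by (simp add: field_simps)
    finally have 2: "padic_abs p (X m - X n) * padic_abs p (Y n) < e" .
    have "X m * Y m - X n * Y n = X m * (Y m - Y n) + (X m - X n) * Y n"
      by (simp add: algebra_simps)
    then show ?thesis
      using padic_abs_add[OF p, of "X m * (Y m - Y n)" "(X m - X n) * Y n"] 1 2
      by (simp add: padic_abs_mult[OF p])
  qed
  then show "\<exists>N. \<forall>m\<ge>N. \<forall>n\<ge>N. padic_abs p (X m * Y m - X n * Y n) < e" by blast
qed

lemma padic_cauchy_ring_simps [simp]:
  "carrier (padic_cauchy_ring p) = {X. padic_cauchy p X}"
  "X \<otimes>\<^bsub>padic_cauchy_ring p\<^esub> Y = (\<lambda>n. X n * Y n)"
  "X \<oplus>\<^bsub>padic_cauchy_ring p\<^esub> Y = (\<lambda>n. X n + Y n)"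
  "\<one>\<^bsub>padic_cauchy_ring p\<^esub> = (\<lambda>n. 1)"
  "\<zero>\<^bsub>padic_cauchy_ring p\<^esub> = (\<lambda>n. 0)"
  by (simp_all add: padic_cauchy_ring_def)

lemma cring_padic_cauchy_ring:
  assumes p: "prime p"
  shows "cring (padic_cauchy_ring p)"
proof (rule cringI)
  show "abelian_group (padic_cauchy_ring p)"
  proof (rule abelian_groupI)
    fix X assume "X \<in> carrier (padic_cauchy_ring p)"
    then show "\<exists>Y\<in>carrier (padic_cauchy_ring p).
        Y \<oplus>\<^bsub>padic_cauchy_ring p\<^esub> X = \<zero>\<^bsub>padic_cauchy_ring p\<^esub>"
      using padic_cauchy_minus[OF p] by (intro bexI[of _ "\<lambda>n. - X n"]) auto
  qed (auto simp: padic_cauchy_add[OF p] add_ac)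
  show "comm_monoid (padic_cauchy_ring p)"
    by (rule comm_monoidI) (auto simp: padic_cauchy_mult[OF p] mult_ac)
qed (auto simp: algebra_simps)

lemma padic_null_cauchy:
  assumes p: "prime p" and X: "X \<in> padic_null p"
  shows "padic_cauchy p X"
  unfolding padic_cauchy_def
proof (intro allI impI)
  fix e :: real assume "e > 0"
  then obtain N where N: "\<And>n. n \<ge> N \<Longrightarrow> padic_abs p (X n) < e"
    using X LIMSEQ_D[of "\<lambda>n. padic_abs p (X n)" 0 e] unfolding padic_null_def by auto
  have "padic_abs p (X m - X n) < e" if "m \<ge> N" "n \<ge> N" for m n
    using padic_abs_add[OF p, of "X m" "- X n"] N[of m] N[of n] that
    by (simp add: padic_abs_minus[OF p])
  then show "\<exists>N. \<forall>m\<ge>N. \<forall>n\<ge>N. padic_abs p (X m - X n) < e" by blast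
qed

lemma padic_null_add:
  assumes p: "prime p" and "X \<in> padic_null p" "Y \<in> padic_null p"
  shows "(\<lambda>n. X n + Y n) \<in> padic_null p"
proof -
  have "(\<lambda>n. padic_abs p (X n) + padic_abs p (Y n)) \<longlonglongrightarrow> 0 + 0"
    using assms(2,3) unfolding padic_null_def by (intro tendsto_add) auto
  then have "(\<lambda>n. padic_abs p (X n) + padic_abs p (Y n)) \<longlonglongrightarrow> 0" by simp
  then have "(\<lambda>n. padic_abs p (X n + Y n)) \<longlonglongrightarrow> 0"
    by (rule tendsto_0_le[where K = 1]) (simp add: padic_abs_add_le[OF p])
  then show ?thesis by (simp add: padic_null_def)
qed

lemma padic_null_minus:
  "prime p \<Longrightarrow> X \<in> padic_null p \<Longrightarrow> (\<lambda>n. - X n) \<in> padic_null p"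
  by (simp add: padic_null_def)

lemma padic_null_mult:
  assumes p: "prime p" and X: "padic_cauchy p X" and Y: "Y \<in> padic_null p"
  shows "(\<lambda>n. X n * Y n) \<in> padic_null p"
proof -
  obtain r where "(\<lambda>n. padic_abs p (X n)) \<longlonglongrightarrow> r"
    using padic_cauchy_convergent[OF p X] by (auto simp: convergent_def)
  then have "(\<lambda>n. padic_abs p (X n) * padic_abs p (Y n)) \<longlonglongrightarrow> r * 0"
    using Y unfolding padic_null_def by (intro tendsto_mult) auto
  then show ?thesis by (simp add: padic_null_def padic_abs_mult[OF p])
qed

lemma ideal_padic_null:
  assumes p: "prime p"
  shows "ideal (padic_null p) (padic_cauchy_ring p)"
proof -
  interpret R: cring "padic_cauchy_ring p" by (rule cring_padic_cauchy_ring[OF p])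
  have inv: "\<ominus>\<^bsub>padic_cauchy_ring p\<^esub> X = (\<lambda>n. - X n)" if "padic_cauchy p X" for X
    using that padic_cauchy_minus[OF p] by (intro R.minus_equality) auto
  show ?thesis
  proof (rule idealI[OF R.ring_axioms])
    show "subgroup (padic_null p) (add_monoid (padic_cauchy_ring p))"
    proof (rule R.add.subgroupI)
      show "padic_null p \<subseteq> carrier (padic_cauchy_ring p)"
        using padic_null_cauchy[OF p] by auto
      have "(\<lambda>n. 0) \<in> padic_null p" by (simp add: padic_null_def)
      then show "padic_null p \<noteq> {}" by blast
    qed (auto simp: inv padic_null_cauchy[OF p] padic_null_minus[OF p] padic_null_add[OF p])
    fix X Y assume "X \<in> padic_null p" "Y \<in> carrier (padic_cauchy_ring p)"
    then show "Y \<otimes>\<^bsub>padic_cauchy_ring p\<^esub> X \<in> padic_null p"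
      "X \<otimes>\<^bsub>padic_cauchy_ring p\<^esub> Y \<in> padic_null p"
      using padic_null_mult[OF p, of Y X] by (auto simp: mult.commute)
  qed
qed

lemma cring_padic_field: "prime p \<Longrightarrow> cring (padic_field p)"
  unfolding padic_field_def
  by (rule ideal.quotient_is_cring[OF ideal_padic_null cring_padic_cauchy_ring])

lemma padic_class_hom:
  "prime p \<Longrightarrow> padic_class p \<in> ring_hom (padic_cauchy_ring p) (padic_field p)"
  using ideal.rcos_ring_hom[OF ideal_padic_null]
  unfolding padic_field_def padic_class_def[abs_def] by simp

lemma padic_class_iff:
  assumes p: "prime p"
  shows "Y \<in> padic_class p X \<longleftrightarrow> (\<lambda>n. Y n - X n) \<in> padic_null p"
proof -
  have "Y \<in> padic_class p X \<longleftrightarrow> (\<exists>Z\<in>padic_null p. Y = (\<lambda>n. Z n + X n))"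
    by (auto simp: padic_class_def a_r_coset_def')
  also have "\<dots> \<longleftrightarrow> (\<lambda>n. Y n - X n) \<in> padic_null p"
    by (auto intro!: bexI[of _ "\<lambda>n. Y n - X n"])
  finally show ?thesis .
qed

lemma padic_field_cases:
  assumes "prime p" "x \<in> carrier (padic_field p)"
  obtains X where "padic_cauchy p X" "x = padic_class p X"
  using assms(2) by (auto simp: padic_field_def FactRing_def A_RCOSETS_def' padic_class_def)

lemma padic_norm_class:
  assumes p: "prime p" and X: "padic_cauchy p X"
  shows "(\<lambda>n. padic_abs p (X n)) \<longlonglongrightarrow> padic_norm p (padic_class p X)"
proof -
  obtain r where r: "(\<lambda>n. padic_abs p (X n)) \<longlonglongrightarrow> r"
    using padic_cauchy_convergent[OF p X] by (auto simp: convergent_def)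
  have *: "(\<lambda>n. padic_abs p (Y n)) \<longlonglongrightarrow> r" if "Y \<in> padic_class p X" for Y
  proof -
    have "(\<lambda>n. padic_abs p (Y n - X n)) \<longlonglongrightarrow> 0"
      using that unfolding padic_class_iff[OF p] by (simp add: padic_null_def)
    then have "(\<lambda>n. padic_abs p (Y n) - padic_abs p (X n)) \<longlonglongrightarrow> 0"
      by (rule tendsto_0_le[where K = 1])
         (simp_all add: padic_abs_diff_le[OF p])
    from tendsto_add[OF this r] show ?thesis by simp
  qed
  have XX: "X \<in> padic_class p X"
    by (simp add: padic_class_iff[OF p] padic_null_def)
  have "padic_norm p (padic_class p X) = r"
    unfolding padic_norm_def using * XX LIMSEQ_unique by (intro the_equality) blast+
  then show ?thesis using r by simp
qed

lemma padic_norm_of_int: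
  assumes "prime p"
  shows "padic_norm p (padic_of_int p k) = padic_abs p (of_int k)"
  using padic_norm_class[OF assms padic_cauchy_const, of "of_int k"]
  by (simp add: padic_of_int_def LIMSEQ_const_iff)

lemma padic_class_closed:
  "prime p \<Longrightarrow> padic_cauchy p X \<Longrightarrow> padic_class p X \<in> carrier (padic_field p)"
  using ring_hom_closed[OF padic_class_hom] by simp

lemma padic_class_eq_zero_iff:
  assumes p: "prime p" and X: "padic_cauchy p X"
  shows "padic_class p X = \<zero>\<^bsub>padic_field p\<^esub> \<longleftrightarrow> X \<in> padic_null p"
proof
  have 0: "\<zero>\<^bsub>padic_field p\<^esub> = padic_null p"
    by (simp add: padic_field_def FactRing_def)
  have XX: "X \<in> padic_class p X"
    by (simp add: padic_class_iff[OF p] padic_null_def)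
  show "X \<in> padic_null p" if "padic_class p X = \<zero>\<^bsub>padic_field p\<^esub>"
    using that XX 0 by simp
  show "padic_class p X = \<zero>\<^bsub>padic_field p\<^esub>" if "X \<in> padic_null p"
    unfolding 0 using that ideal_padic_null[OF p] cring.axioms(1)[OF cring_padic_cauchy_ring[OF p]]
    by (simp add: padic_class_def ring.a_rcos_zero)
qed

lemma padic_norm_eq_0_iff:
  assumes p: "prime p" and x: "x \<in> carrier (padic_field p)"
  shows "padic_norm p x = 0 \<longleftrightarrow> x = \<zero>\<^bsub>padic_field p\<^esub>"
proof -
  obtain X where X: "padic_cauchy p X" "x = padic_class p X"
    using padic_field_cases[OF p x] .
  show ?thesis
    using padic_norm_class[OF p X(1)] LIMSEQ_unique
    unfolding X(2) padic_class_eq_zero_iff[OF p X(1)] padic_null_def by force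
qed

lemma field_padic_field:
  assumes p: "prime p"
  shows "field (padic_field p)"
proof (rule cring.cring_fieldI2[OF cring_padic_field[OF p]])
  have one: "\<one>\<^bsub>padic_field p\<^esub> = padic_class p (\<lambda>n. 1)"
    using ring_hom_one[OF padic_class_hom[OF p]] by simp
  show "\<zero>\<^bsub>padic_field p\<^esub> \<noteq> \<one>\<^bsub>padic_field p\<^esub>"
    unfolding one using padic_class_eq_zero_iff[OF p padic_cauchy_const, of 1] p
    by (auto simp: padic_null_def LIMSEQ_const_iff dest: sym)
  fix x assume x: "x \<in> carrier (padic_field p)" "x \<noteq> \<zero>\<^bsub>padic_field p\<^esub>"
  obtain X where X: "padic_cauchy p X" "x = padic_class p X"
    using padic_field_cases[OF p x(1)] .
  define r where "r = padic_norm p x"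
  have lim: "(\<lambda>n. padic_abs p (X n)) \<longlonglongrightarrow> r"
    using padic_norm_class[OF p X(1)] by (simp add: r_def X(2))
  have "r \<ge> 0" using lim by (rule LIMSEQ_le_const) auto
  moreover have "r \<noteq> 0" using padic_norm_eq_0_iff[OF p x(1)] x(2) by (simp add: r_def)
  ultimately have r: "r > 0" by simp
  then have "\<forall>\<^sub>F n in sequentially. padic_abs p (X n) > r / 2"
    by (intro order_tendstoD(1)[OF lim]) auto
  then obtain M where M: "\<And>n. n \<ge> M \<Longrightarrow> padic_abs p (X n) > r / 2"
    by (auto simp: eventually_sequentially)
  have X0: "X n \<noteq> 0" if "n \<ge> M" for n using M[OF that] r by auto
  define Y where "Y n = inverse (X n)" for n
  have "padic_cauchy p Y"
    unfolding padic_cauchy_def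
  proof (intro allI impI)
    fix e :: real assume e: "e > 0"
    then have "e * (r / 2 * (r / 2)) > 0" using r by simp
    then obtain N where
      N: "\<And>m n. m \<ge> N \<Longrightarrow> n \<ge> N \<Longrightarrow> padic_abs p (X m - X n) < e * (r / 2 * (r / 2))"
      using X(1) unfolding padic_cauchy_def by meson
    have "padic_abs p (Y m - Y n) < e" if mn: "m \<ge> max M N" "n \<ge> max M N" for m n
    proof -
      have "(Y m - Y n) * (X m * X n) = X n - X m"
        using X0[of m] X0[of n] mn by (simp add: Y_def field_simps)
      then have "padic_abs p (Y m - Y n) * (padic_abs p (X m) * padic_abs p (X n))
          = padic_abs p (X n - X m)"
        by (metis padic_abs_mult[OF p])
      also have "\<dots> < e * (r / 2 * (r / 2))" using N mn by simp
      also have "\<dots> \<le> e * (padic_abs p (X m) * padic_abs p (X n))"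
        using M[of m] M[of n] mn e r by (intro mult_left_mono mult_mono) auto
      finally show ?thesis
        by (rule mult_right_less_imp_less) simp
    qed
    then show "\<exists>N. \<forall>m\<ge>N. \<forall>n\<ge>N. padic_abs p (Y m - Y n) < e" by blast
  qed
  note Y = this
  have "padic_class p X \<otimes>\<^bsub>padic_field p\<^esub> padic_class p Y = padic_class p (\<lambda>n. X n * Y n)"
    using ring_hom_mult[OF padic_class_hom[OF p], of X Y] X Y by simp
  also have "\<dots> = padic_class p (\<lambda>n. 1)"
  proof -
    have ev: "\<forall>\<^sub>F n in sequentially. X n * Y n = 1"
      using X0 by (auto simp: eventually_sequentially Y_def intro!: exI[of _ M])
    have "(\<lambda>n. X n * Y n) \<in> padic_class p (\<lambda>n. 1)"
      unfolding padic_class_iff[OF p] padic_null_def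
      using ev by (intro CollectI tendsto_eventually) (simp add: eventually_mono)
    moreover have "abelian_subgroup (padic_null p) (padic_cauchy_ring p)"
      by (rule abelian_subgroupI3[OF ideal.axioms(1)[OF ideal_padic_null[OF p]]
            ring.is_abelian_group[OF cring.axioms(1)[OF cring_padic_cauchy_ring[OF p]]]])
    ultimately show ?thesis
      unfolding padic_class_def
      by (metis abelian_subgroup.a_repr_independence' mem_Collect_eq padic_cauchy_const
          padic_cauchy_ring_simps(1))
  qed
  finally show "\<exists>y\<in>carrier (padic_field p). x \<otimes>\<^bsub>padic_field p\<^esub> y = \<one>\<^bsub>padic_field p\<^esub>"
    unfolding X(2) one by (intro bexI[OF _ padic_class_closed[OF p Y]])
qed

lemma padic_class_minus:
  assumes p: "prime p" and X: "padic_cauchy p X" and Y: "padic_cauchy p Y"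
  shows "padic_class p X \<ominus>\<^bsub>padic_field p\<^esub> padic_class p Y = padic_class p (\<lambda>n. X n - Y n)"
proof -
  interpret K: cring "padic_field p" by (rule cring_padic_field[OF p])
  have D: "padic_cauchy p (\<lambda>n. X n - Y n)"
    using padic_cauchy_add[OF p X padic_cauchy_minus[OF p Y]] by simp
  have "padic_class p X = padic_class p (\<lambda>n. X n - Y n) \<oplus>\<^bsub>padic_field p\<^esub> padic_class p Y"
    using ring_hom_add[OF padic_class_hom[OF p], of "\<lambda>n. X n - Y n" Y] D Y by simp
  then show ?thesis
    using padic_class_closed[OF p D] padic_class_closed[OF p Y]
    by (simp add: K.minus_eq K.a_assoc K.r_neg)
qed

lemma padic_norm_add_le:
  assumes p: "prime p" and x: "x \<in> carrier (padic_field p)" and y: "y \<in> carrier (padic_field p)"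
  shows "padic_norm p (x \<oplus>\<^bsub>padic_field p\<^esub> y) \<le> padic_norm p x + padic_norm p y"
proof -
  obtain X where X: "padic_cauchy p X" "x = padic_class p X" using padic_field_cases[OF p x] .
  obtain Y where Y: "padic_cauchy p Y" "y = padic_class p Y" using padic_field_cases[OF p y] .
  have "x \<oplus>\<^bsub>padic_field p\<^esub> y = padic_class p (\<lambda>n. X n + Y n)"
    using ring_hom_add[OF padic_class_hom[OF p], of X Y] X Y by simp
  then show ?thesis
    using LIMSEQ_le[OF padic_norm_class[OF p padic_cauchy_add[OF p X(1) Y(1)]]
        tendsto_add[OF padic_norm_class[OF p X(1)] padic_norm_class[OF p Y(1)]]]
      padic_abs_add_le[OF p] X(2) Y(2) by auto
qed

lemma padic_norm_minus_commute:
  assumes p: "prime p" and x: "x \<in> carrier (padic_field p)" and y: "y \<in> carrier (padic_field p)"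
  shows "padic_norm p (x \<ominus>\<^bsub>padic_field p\<^esub> y) = padic_norm p (y \<ominus>\<^bsub>padic_field p\<^esub> x)"
proof -
  obtain X where X: "padic_cauchy p X" "x = padic_class p X" using padic_field_cases[OF p x] .
  obtain Y where Y: "padic_cauchy p Y" "y = padic_class p Y" using padic_field_cases[OF p y] .
  have D: "padic_cauchy p (\<lambda>n. X n - Y n)" "padic_cauchy p (\<lambda>n. Y n - X n)"
    using padic_cauchy_add[OF p X(1) padic_cauchy_minus[OF p Y(1)]]
      padic_cauchy_add[OF p Y(1) padic_cauchy_minus[OF p X(1)]] by simp_all
  have "padic_abs p (X n - Y n) = padic_abs p (Y n - X n)" for n
    using padic_abs_minus[OF p, of "X n - Y n"] by simp
  then show ?thesis
    using padic_norm_class[OF p D(1)] padic_norm_class[OF p D(2)] LIMSEQ_unique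
    by (simp add: X(2) Y(2) padic_class_minus[OF p] X(1) Y(1))
qed

lemma padic_sums_unique:
  assumes p: "prime p" and f: "\<And>n. f n \<in> carrier (padic_field p)"
    and s: "padic_sums p f s" and s': "padic_sums p f s'"
  shows "s = s'"
proof -
  interpret K: cring "padic_field p" by (rule cring_padic_field[OF p])
  define S where "S N = (\<Oplus>\<^bsub>padic_field p\<^esub>n\<in>{..<N}. f n)" for N :: nat
  have S: "S N \<in> carrier (padic_field p)" for N
    unfolding S_def using f by (intro K.finsum_closed) auto
  have c: "s \<in> carrier (padic_field p)" "s' \<in> carrier (padic_field p)"
    using s s' by (auto simp: padic_sums_def)
  have "padic_norm p (s \<ominus>\<^bsub>padic_field p\<^esub> s') \<le>
      padic_norm p (S N \<ominus>\<^bsub>padic_field p\<^esub> s) + padic_norm p (S N \<ominus>\<^bsub>padic_field p\<^esub> s')" for N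
  proof -
    have "s \<ominus>\<^bsub>padic_field p\<^esub> s' =
        (s \<ominus>\<^bsub>padic_field p\<^esub> S N) \<oplus>\<^bsub>padic_field p\<^esub> (S N \<ominus>\<^bsub>padic_field p\<^esub> s')"
      using S[of N] c by (simp add: K.minus_eq K.a_assoc K.r_neg1)
    then show ?thesis
      using padic_norm_add_le[OF p, of "s \<ominus>\<^bsub>padic_field p\<^esub> S N" "S N \<ominus>\<^bsub>padic_field p\<^esub> s'"]
        S[of N] c padic_norm_minus_commute[OF p, of s "S N"] by simp
  qed
  moreover have "(\<lambda>N. padic_norm p (S N \<ominus>\<^bsub>padic_field p\<^esub> s)
      + padic_norm p (S N \<ominus>\<^bsub>padic_field p\<^esub> s')) \<longlonglongrightarrow> 0 + 0"
    using s s' unfolding padic_sums_def S_def by (intro tendsto_add) auto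
  ultimately have le: "padic_norm p (s \<ominus>\<^bsub>padic_field p\<^esub> s') \<le> 0"
    by (intro LIMSEQ_le_const[where X = "\<lambda>N. padic_norm p (S N \<ominus>\<^bsub>padic_field p\<^esub> s)
      + padic_norm p (S N \<ominus>\<^bsub>padic_field p\<^esub> s')"]) auto
  obtain D where D: "padic_cauchy p D" "s \<ominus>\<^bsub>padic_field p\<^esub> s' = padic_class p D"
    using padic_field_cases[OF p K.minus_closed[OF c]] .
  have "padic_norm p (s \<ominus>\<^bsub>padic_field p\<^esub> s') \<ge> 0"
    unfolding D(2) using padic_norm_class[OF p D(1)] by (rule LIMSEQ_le_const) auto
  with le have "s \<ominus>\<^bsub>padic_field p\<^esub> s' = \<zero>\<^bsub>padic_field p\<^esub>"
    using padic_norm_eq_0_iff[OF p K.minus_closed[OF c]] by simp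
  then have "s = \<ominus>\<^bsub>padic_field p\<^esub> (\<ominus>\<^bsub>padic_field p\<^esub> s')"
    using c by (intro sym[OF K.minus_equality]) (auto simp: K.minus_eq)
  then show ?thesis using c by simp
qed

text \<open>
  At an integer \<open>t\<close> in the open unit disc the series converges, so that the definite description
  in \<^const>\<open>padic_suminf\<close> denotes its sum.
\<close>

lemma E_p_sums:
  fixes t :: int
  assumes p: "prime p" and t: "padic_abs p (of_int t) < 1"
  defines "f \<equiv> (\<lambda>n. padic_of_int p (fact n) \<otimes>\<^bsub>padic_field p\<^esub>
      (padic_of_int p t [^]\<^bsub>padic_field p\<^esub> n))"
    and "X \<equiv> (\<lambda>N. \<Sum>n<N. fact n * of_int t ^ n)"
  shows "padic_cauchy p X" "padic_sums p f (padic_class p X)"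
    "E_p p (padic_of_int p t) = padic_class p X"
proof -
  interpret K: cring "padic_field p" by (rule cring_padic_field[OF p])
  have pow: "padic_of_int p t [^]\<^bsub>padic_field p\<^esub> n = padic_class p (\<lambda>_. of_int t ^ n)" for n :: nat
  proof (induction n)
    case 0
    then show ?case using ring_hom_one[OF padic_class_hom[OF p]] by simp
  next
    case (Suc n)
    then show ?case
      using ring_hom_mult[OF padic_class_hom[OF p], of "\<lambda>_. of_int t ^ n" "\<lambda>_. of_int t"]
      by (simp add: padic_of_int_def mult.commute)
  qed
  have f: "f n = padic_class p (\<lambda>_. fact n * of_int t ^ n)" for n
    using ring_hom_mult[OF padic_class_hom[OF p], of "\<lambda>_. fact n" "\<lambda>_. of_int t ^ n"]
    unfolding f_def pow by (simp add: padic_of_int_def)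
  have fc: "f n \<in> carrier (padic_field p)" for n
    unfolding f by (rule padic_class_closed[OF p]) simp
  have S: "(\<Oplus>\<^bsub>padic_field p\<^esub>n\<in>{..<N}. f n) = padic_class p (\<lambda>_. X N)" for N
  proof (induction N)
    case 0
    then show ?case
      using padic_class_eq_zero_iff[OF p padic_cauchy_const, of 0]
      by (simp add: X_def padic_null_def)
  next
    case (Suc N)
    have "(\<Oplus>\<^bsub>padic_field p\<^esub>n\<in>{..<Suc N}. f n) = f N \<oplus>\<^bsub>padic_field p\<^esub> padic_class p (\<lambda>_. X N)"
      using fc by (simp add: lessThan_Suc Suc.IH)
    also have "\<dots> = padic_class p (\<lambda>_. X (Suc N))"
      using ring_hom_add[OF padic_class_hom[OF p], of "\<lambda>_. fact N * of_int t ^ N" "\<lambda>_. X N"]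
      by (simp add: f X_def add.commute)
    finally show ?case .
  qed
  define q where "q = padic_abs p (of_int t)"
  have q: "0 \<le> q" "q < 1" using t by (auto simp: q_def)
  have abs_pow: "padic_abs p (x ^ n) = padic_abs p x ^ n" for x n
    by (induction n) (auto simp: padic_abs_mult[OF p] p)
  have summand: "padic_abs p (fact n * of_int t ^ n) \<le> q ^ n" for n
  proof -
    have "padic_abs p (fact n) = 1 / real p ^ multiplicity (int p) (fact n)"
      using padic_abs_of_int[OF p, of "fact n"] by simp
    also have "\<dots> \<le> 1" using prime_ge_1_nat[OF p] by simp
    finally have "padic_abs p (fact n) \<le> 1" .
    then show ?thesis
      using q by (simp add: padic_abs_mult[OF p] abs_pow flip: q_def)
        (simp add: mult_left_le_one_le)
  qed
  have tail: "padic_abs p (X (N + k) - X N) \<le> q ^ N" for N k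
  proof (induction k)
    case 0
    then show ?case using q by simp
  next
    case (Suc k)
    have eq: "X (N + Suc k) - X N = (X (N + k) - X N) + fact (N + k) * of_int t ^ (N + k)"
      by (simp add: X_def)
    have "q ^ (N + k) \<le> q ^ N" using q by (intro power_decreasing) auto
    then show ?case
      unfolding eq
      using padic_abs_add[OF p, of "X (N + k) - X N" "fact (N + k) * of_int t ^ (N + k)"]
        Suc.IH summand[of "N + k"] by linarith
  qed
  have tail': "padic_abs p (X m - X n) \<le> q ^ N" if "m \<ge> N" "n \<ge> N" for m n N
    using tail[of N "m - N"] tail[of N "n - N"] that
      padic_abs_add[OF p, of "X m - X N" "X N - X n"] padic_abs_minus[OF p, of "X n - X N"]
    by simp
  have qlim: "(\<lambda>N. q ^ N) \<longlonglongrightarrow> 0" using q by (intro LIMSEQ_power_zero) auto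
  show X: "padic_cauchy p X"
    unfolding padic_cauchy_def
  proof (intro allI impI)
    fix e :: real assume "e > 0"
    then have "\<forall>\<^sub>F N in sequentially. q ^ N < e" using order_tendstoD(2)[OF qlim] by blast
    then obtain N where "q ^ N < e" by (auto simp: eventually_sequentially)
    then show "\<exists>N. \<forall>m\<ge>N. \<forall>n\<ge>N. padic_abs p (X m - X n) < e"
      using tail' by (meson order_le_less_trans)
  qed
  have DX: "padic_cauchy p (\<lambda>n. X N - X n)" for N
    using padic_cauchy_add[OF p padic_cauchy_const padic_cauchy_minus[OF p X], of "X N"] by simp
  have up: "padic_norm p (padic_class p (\<lambda>n. X N - X n)) \<le> q ^ N" for N
    using padic_norm_class[OF p DX] by (rule LIMSEQ_le_const2) (auto intro!: tail' exI[of _ N])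
  have lo: "padic_norm p (padic_class p (\<lambda>n. X N - X n)) \<ge> 0" for N
    using padic_norm_class[OF p DX] by (rule LIMSEQ_le_const) auto
  have "(\<lambda>N. padic_norm p (padic_class p (\<lambda>n. X N - X n))) \<longlonglongrightarrow> 0"
    by (rule real_tendsto_sandwich[OF _ _ tendsto_const qlim]) (simp_all add: up lo)
  then show sums: "padic_sums p f (padic_class p X)"
    unfolding padic_sums_def S using padic_class_closed[OF p X] X
    by (simp add: padic_class_minus[OF p])
  show "E_p p (padic_of_int p t) = padic_class p X"
    unfolding E_p_def padic_suminf_def f_def[symmetric]
    using sums padic_sums_unique[OF p fc] by (intro the_equality) auto
qed

end

theory Submission
  imports Defs
begin

text \<open>
  The Pad\'e approximants of \<open>\<Sum>n. n! t^n\<close> have Laguerre polynomials as denominators. Numerators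
  \<open>P\<close> and denominators \<open>Q\<close> satisfy the same three-term recurrence, which gives the three facts
  needed: \<open>Q n * P (n + 1) - Q (n + 1) * P n = n!^2 t^(2n)\<close> does not vanish, so that
  \<open>d * P k - c * Q k\<close> is a nonzero integer for \<open>k = l\<close> or \<open>k = l + 1\<close>; the remainder \<open>Q k * E - P k\<close>
  is divisible by \<open>t^(2k)\<close>; and \<open>P k\<close>, \<open>Q k\<close> are at most \<open>k! |t|^k\<close> times the Laguerre polynomial
  at \<open>- 1 / |t|\<close>. A nonzero integer \<open>m\<close> has \<open>|m| |m|_p \<ge> 1\<close>, which contradicts the smallness of
  \<open>d * E - c\<close>.
\<close>

section \<open>Pade polynomials and their Casoratian\<close>

text \<open>For \<open>t\<close> nonzero this is \<open>n! (-t)^n L_n(1/t)\<close> with the Laguerre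
  polynomial \<open>L_n\<close>; the scaling keeps all values integral.\<close>

fun pade_den :: "int \<Rightarrow> nat \<Rightarrow> int" where
  "pade_den t 0 = 1"
| "pade_den t (Suc 0) = 1 - t"
| "pade_den t (Suc (Suc n)) =
     (1 - (2 * int n + 3) * t) * pade_den t (Suc n) - (int n + 1)^2 * t^2 * pade_den t n"

text \<open>The second solution of the recurrence. Its initial values 0 and 1 make
  \<open>Q n * E - P n\<close> divisible by \<open>t^(2n)\<close> for \<open>n = 0\<close> and
  \<open>n = 1\<close>.\<close>

fun pade_num :: "int \<Rightarrow> nat \<Rightarrow> int" where
  "pade_num t 0 = 0"
| "pade_num t (Suc 0) = 1"
| "pade_num t (Suc (Suc n)) =
     (1 - (2 * int n + 3) * t) * pade_num t (Suc n) - (int n + 1)^2 * t^2 * pade_num t n"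

text \<open>The middle coefficient of the recurrence cancels, so each step just multiplies by
  \<open>(n + 1)^2 t^2\<close>.\<close>

lemma pade_casoratian:
  "pade_den t n * pade_num t (Suc n) - pade_den t (Suc n) * pade_num t n = (fact n)^2 * t^(2 * n)"
proof (induction n)
  case (Suc n)
  have "pade_den t (Suc n) * pade_num t (Suc (Suc n))
        - pade_den t (Suc (Suc n)) * pade_num t (Suc n)
      = (int n + 1)^2 * t^2 *
        (pade_den t n * pade_num t (Suc n) - pade_den t (Suc n) * pade_num t n)"
    by (simp add: algebra_simps)
  then show ?case
    unfolding Suc.IH by (simp add: power_mult_distrib power2_eq_square algebra_simps)
qed simp

section \<open>Remainder series and its divisibility\<close>

text \<open>
  The remainder is \<open>t^(2l) * (\<Sum>m. ((m + l)!)^2 / m! * t^m)\<close>.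
\<close>

definition rem_coeff :: "nat \<Rightarrow> nat \<Rightarrow> int" where
  "rem_coeff l m = fact (m + l) * fact l * int ((m + l) choose l)"

text \<open>Lets identities between coefficients be checked after multiplication by a factorial,
  without integer division.\<close>

lemma fact_mult_rem_coeff: "fact m * rem_coeff l m = (fact (m + l))^2"
proof -
  have "fact l * fact m * ((m + l) choose l) = (fact (m + l) :: nat)"
    using binomial_fact_lemma[of l "m + l"] by simp
  then have "fact l * fact m * int ((m + l) choose l) = fact (m + l)"
    by (metis of_nat_mult of_nat_fact)
  then show ?thesis
    by (simp add: rem_coeff_def power2_eq_square mult_ac)
qed

text \<open>This compares coefficients of \<open>t^(m+2)\<close> in the recurrence for the
  remainders. Multiplied by \<open>(m+2)!\<close>, every term is a multiple of \<open>F^2\<close>,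
  and what remains is \<open>(m+l+3)^2 - (l+1)^2 - (2l+3)(m+2) = (m+2)(m+1)\<close>.\<close>

lemma rem_coeff_recurrence:
  "rem_coeff (Suc (Suc l)) m = rem_coeff (Suc l) (Suc (Suc m))
     - (int l + 1)^2 * rem_coeff l (Suc (Suc m)) - (2 * int l + 3) * rem_coeff (Suc l) (Suc m)"
    (is "?L = ?R")
proof -
  define F :: int where "F = fact (m + l + 2)"
  have F1: "fact (m + l + 3) = (int m + int l + 3) * F"
    using fact_Suc[of "m + l + 2"] by (simp add: F_def eval_nat_numeral algebra_simps)
  have f2: "(fact (Suc (Suc m)) :: int) = (int m + 2) * (int m + 1) * fact m"
    by (simp add: algebra_simps)
  have f1: "(fact (Suc (Suc m)) :: int) = (int m + 2) * fact (Suc m)"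
    by (simp add: algebra_simps)
  have a: "fact (Suc (Suc m)) * rem_coeff (Suc (Suc l)) m = (int m + 2) * (int m + 1) * F^2"
    using fact_mult_rem_coeff[of m "Suc (Suc l)"] unfolding f2
    by (simp add: F_def mult.assoc)
  have b: "fact (Suc (Suc m)) * rem_coeff (Suc l) (Suc (Suc m)) = ((int m + int l + 3) * F)^2"
    using fact_mult_rem_coeff[of "Suc (Suc m)" "Suc l"] F1
    by (simp add: eval_nat_numeral del: fact_Suc)
  have c: "fact (Suc (Suc m)) * rem_coeff l (Suc (Suc m)) = F^2"
    using fact_mult_rem_coeff[of "Suc (Suc m)" l]
    by (simp add: F_def eval_nat_numeral del: fact_Suc)
  have d: "fact (Suc (Suc m)) * rem_coeff (Suc l) (Suc m) = (int m + 2) * F^2"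
    using fact_mult_rem_coeff[of "Suc m" "Suc l"] unfolding f1
    by (simp add: F_def eval_nat_numeral mult.assoc del: fact_Suc)
  have "fact (Suc (Suc m)) * ?R = ((int m + int l + 3) * F)^2
      - (int l + 1)^2 * F^2 - (2 * int l + 3) * ((int m + 2) * F^2)"
    unfolding right_diff_distrib b mult.left_commute[of "fact (Suc (Suc m))"] c d by simp
  also have "\<dots> = (int m + 2) * (int m + 1) * F^2"
    by (simp add: power2_eq_square algebra_simps)
  finally have "fact (Suc (Suc m)) * ?L = fact (Suc (Suc m)) * ?R" using a by simp
  then show ?thesis by (simp del: fact_Suc)
qed

lemma rem_coeff_0: "rem_coeff 0 m = fact m"
  by (simp add: rem_coeff_def)

lemma rem_coeff_1: "rem_coeff (Suc 0) m = (int m + 1) * fact (Suc m)"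
  by (simp add: rem_coeff_def algebra_simps)

text \<open>The coefficients of \<open>t^0\<close> and \<open>t^1\<close> in the same comparison,
  where the factor \<open>t^2\<close> leaves no contribution from \<open>l + 2\<close>.\<close>

lemma rem_coeff_start:
  "rem_coeff (Suc l) 0 = (int l + 1)^2 * rem_coeff l 0"
  "rem_coeff (Suc l) (Suc 0) - (int l + 1)^2 * rem_coeff l (Suc 0)
     = (2 * int l + 3) * rem_coeff (Suc l) 0"
  by (simp_all add: rem_coeff_def power2_eq_square algebra_simps)

text \<open>
  The remainder series satisfies the recurrence exactly; the right-hand side below is what truncation
  at \<open>N\<close> leaves over, and only its factor \<open>t^N\<close> matters.
\<close>

lemma rem_sum_recurrence:
  fixes t :: int and l :: nat
  defines "u \<equiv> \<lambda>m. rem_coeff (Suc l) m - (int l + 1)^2 * rem_coeff l m"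
  shows "(1 - (2 * int l + 3) * t) * (\<Sum>m<N. rem_coeff (Suc l) m * t^m)
       - (int l + 1)^2 * (\<Sum>m<N. rem_coeff l m * t^m)
       - t^2 * (\<Sum>m<N. rem_coeff (Suc (Suc l)) m * t^m)
     = - (t^N * (u N + (u (Suc N) - (2 * int l + 3) * rem_coeff (Suc l) N) * t))"
proof (induction N)
  case 0
  then show ?case using rem_coeff_start[of l] by (simp add: u_def)
next
  case (Suc N)
  \<comment> \<open>The new leftover coefficient equals the one that the third sum gains at
    \<open>N\<close>.\<close>
  have v: "u (Suc (Suc N)) - (2 * int l + 3) * rem_coeff (Suc l) (Suc N) = rem_coeff (Suc (Suc l)) N"
    using rem_coeff_recurrence[of l N] by (simp add: u_def)
  show ?case
    unfolding sum.lessThan_Suc v using Suc.IH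
    by (simp add: u_def algebra_simps power2_eq_square)
qed

lemma rem_sum_1:
  fixes t :: int
  shows "(1 - t) * (\<Sum>m<N. fact m * t^m) - 1 - t^2 * (\<Sum>m<N. rem_coeff (Suc 0) m * t^m)
    = - (t^N * (fact N + int N * fact N * t))"
  by (induction N) (simp_all add: rem_coeff_1 algebra_simps power2_eq_square)

text \<open>Truncating at \<open>N\<close> and working modulo \<open>t^N\<close> replaces power
  series by integer congruences.\<close>

lemma pade_remainder_cong:
  fixes t :: int
  shows "t^N dvd pade_den t l * (\<Sum>m<N. fact m * t^m) - pade_num t l
    - t^(2 * l) * (\<Sum>m<N. rem_coeff l m * t^m)"
proof (induction l rule: induct_nat_012)
  case 0
  then show ?case by (simp add: rem_coeff_0)
next
  case 1
  then show ?case using rem_sum_1[of t N] by (simp add: eval_nat_numeral)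
next
  case (ge2 l)
  define X where "X = (\<Sum>m<N. fact m * t^m)"
  define S where "S k = (\<Sum>m<N. rem_coeff k m * t^m)" for k
  define a where "a = 1 - (2 * int l + 3) * t"
  define b where "b = (int l + 1)^2"
  have 1: "t^N dvd a * S (Suc l) - b * S l - t^2 * S (Suc (Suc l))"
    using rem_sum_recurrence[of l t N] by (simp add: a_def b_def S_def)
  \<comment> \<open>The three summands are the two induction hypotheses and the leftover of the
    remainder recurrence, each divisible by \<open>t^N\<close>.\<close>
  have eq: "pade_den t (Suc (Suc l)) * X - pade_num t (Suc (Suc l))
        - t^(2 * Suc (Suc l)) * S (Suc (Suc l))
      = a * (pade_den t (Suc l) * X - pade_num t (Suc l) - t^(2 * Suc l) * S (Suc l))
        - b * t^2 * (pade_den t l * X - pade_num t l - t^(2 * l) * S l)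
        + t^(2 * Suc l) * (a * S (Suc l) - b * S l - t^2 * S (Suc (Suc l)))"
    unfolding pade_den.simps pade_num.simps a_def[symmetric] b_def[symmetric]
    by (simp add: algebra_simps power2_eq_square)
  show ?case
    unfolding X_def[symmetric] S_def[symmetric] eq
    using 1 ge2 unfolding X_def[symmetric] S_def[symmetric]
    by (intro dvd_add[OF dvd_diff[OF dvd_mult dvd_mult] dvd_mult])
qed

lemma pade_remainder_dvd:
  fixes t :: int
  assumes "N \<ge> 2 * l"
  shows "t^(2 * l) dvd pade_den t l * (\<Sum>m<N. fact m * t^m) - pade_num t l"
proof -
  have "t^(2 * l) dvd pade_den t l * (\<Sum>m<N. fact m * t^m) - pade_num t l
    - t^(2 * l) * (\<Sum>m<N. rem_coeff l m * t^m)"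
    using pade_remainder_cong by (rule dvd_trans[OF le_imp_power_dvd[OF assms]])
  then show ?thesis by (simp add: dvd_diff_left_iff)
qed

section \<open>Growth of the Laguerre recurrence\<close>

text \<open>The Laguerre polynomial \<open>L_n(-a)\<close>.\<close>

definition laguerre_neg :: "real \<Rightarrow> nat \<Rightarrow> real" where
  "laguerre_neg a n = (\<Sum>j\<le>n. real (n choose j) * a^j / fact j)"

text \<open>The increment \<open>L_(n+1)(-a) - L_n(-a)\<close>, by Pascal's rule.\<close>

definition laguerre_neg_step :: "real \<Rightarrow> nat \<Rightarrow> real" where
  "laguerre_neg_step a n = (\<Sum>j\<le>n. real (n choose j) * a^Suc j / fact (Suc j))"

lemma laguerre_neg_Suc: "laguerre_neg a (Suc n) = laguerre_neg a n + laguerre_neg_step a n"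
proof -
  have "laguerre_neg a (Suc n) = 1 + (\<Sum>j\<le>n. real (Suc n choose Suc j) * a^Suc j / fact (Suc j))"
    unfolding laguerre_neg_def by (subst sum.atMost_Suc_shift) simp
  also have "\<dots> = 1 + (\<Sum>j\<le>n. real (n choose Suc j) * a^Suc j / fact (Suc j)) + laguerre_neg_step a n"
    unfolding laguerre_neg_step_def
    by (simp add: sum.distrib[symmetric] add_divide_distrib[symmetric] distrib_right[symmetric]
        add.commute del: power_Suc fact_Suc)
  also have "1 + (\<Sum>j\<le>n. real (n choose Suc j) * a^Suc j / fact (Suc j))
      = (\<Sum>j\<le>Suc n. real (n choose j) * a^j / fact j)"
    by (subst sum.atMost_Suc_shift) simp
  also have "\<dots> = laguerre_neg a n"
    by (simp add: laguerre_neg_def)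
  finally show ?thesis .
qed

text \<open>Holds term by term: \<open>n + 2 = (j + 1) + (n + 1 - j)\<close>, where
  \<open>j + 1\<close> cancels into \<open>(j+1)!\<close> and \<open>n + 1 - j\<close> is absorbed
  by the binomial coefficient.\<close>

lemma laguerre_neg_step_Suc:
  "real (n + 2) * laguerre_neg_step a (Suc n)
    = a * laguerre_neg a (Suc n) + real (n + 1) * laguerre_neg_step a n"
proof -
  \<comment> \<open>The added term at \<open>j = Suc n\<close> is zero; now all sums share one index
    set.\<close>
  have step: "laguerre_neg_step a n = (\<Sum>j\<le>Suc n. real (n choose j) * a^Suc j / fact (Suc j))"
    by (simp add: laguerre_neg_step_def)
  have "real (n + 2) * (real (Suc n choose j) * a^Suc j / fact (Suc j))
      = a * (real (Suc n choose j) * a^j / fact j)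
        + real (n + 1) * (real (n choose j) * a^Suc j / fact (Suc j))" if "j \<le> Suc n" for j
  proof -
    have "(Suc n - j) * (Suc n choose j) = Suc n * (n choose j)"
      using binomial_absorb_comp[of "Suc n" j] by simp
    then have "(real (Suc n) - real j) * real (Suc n choose j) = real (Suc n) * real (n choose j)"
      using that by (metis of_nat_diff of_nat_mult)
    then have b: "real (n + 2) * real (Suc n choose j)
        = real (Suc j) * real (Suc n choose j) + real (n + 1) * real (n choose j)"
      by (simp add: algebra_simps)
    have "real (n + 2) * (real (Suc n choose j) * a^Suc j / fact (Suc j))
        = (real (n + 2) * real (Suc n choose j)) * (a^Suc j / fact (Suc j))" by simp
    also have "\<dots> = real (Suc n choose j) * a^Suc j * (real (Suc j) / fact (Suc j))
        + real (n + 1) * (real (n choose j) * a^Suc j / fact (Suc j))"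
      unfolding b by (simp only: ring_distribs add_divide_distrib times_divide_eq_left
          times_divide_eq_right mult_ac)
    also have "real (Suc j) / fact (Suc j) = 1 / (fact j :: real)"
      by (simp add: divide_simps)
    finally show ?thesis by simp
  qed
  then show ?thesis
    unfolding step laguerre_neg_step_def[of a "Suc n"] laguerre_neg_def sum_distrib_left
      sum.distrib[symmetric]
    by (intro sum.cong) auto
qed

lemma laguerre_neg_le_exp:
  assumes "a \<ge> 0"
  shows "laguerre_neg a n \<le> exp (2 * sqrt (real n * a))"
proof -
  \<comment> \<open>The terms are at most \<open>(s^j / j!)^2\<close>, and a sum of squares is at most the square of the sum.\<close>
  define s where "s = sqrt (real n * a)"
  have s: "s \<ge> 0" "s^2 = real n * a" using assms by (auto simp: s_def)
  define y where "y j = s^j / fact j" for j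
  have y: "y j \<ge> 0" for j using s by (simp add: y_def)
  have "real (n choose j) * a^j / fact j \<le> y j * y j" for j
  proof -
    have "real (n choose j) * fact j \<le> real n ^ j"
      using binomial_fact_pow[of n j] by (metis of_nat_fact of_nat_le_iff of_nat_mult of_nat_power)
    then have "real (n choose j) \<le> real n ^ j / fact j" by (simp add: field_simps)
    then have "real (n choose j) * (a^j / fact j) \<le> real n ^ j / fact j * (a^j / fact j)"
      using assms by (intro mult_right_mono) auto
    also have "\<dots> = (real n * a)^j / fact j / fact j" by (simp add: power_mult_distrib)
    also have "\<dots> = y j * y j"
      unfolding s(2)[symmetric] y_def
      by (simp add: power2_eq_square power_mult_distrib)
    finally show ?thesis by simp
  qed
  then have "laguerre_neg a n \<le> (\<Sum>j\<le>n. y j * y j)"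
    unfolding laguerre_neg_def by (rule sum_mono)
  also have "\<dots> \<le> (\<Sum>j\<le>n. y j * (\<Sum>i\<le>n. y i))"
    by (intro sum_mono mult_left_mono member_le_sum) (auto simp: y)
  also have "\<dots> = (\<Sum>j\<le>n. y j)^2"
    by (simp add: sum_distrib_right power2_eq_square)
  also have "\<dots> \<le> (exp s)^2"
  proof (rule power_mono)
    have "summable (\<lambda>j. inverse (fact j) * s^j)" by (rule summable_exp)
    then have "summable y" by (simp add: y_def[abs_def] field_simps)
    then have "(\<Sum>j\<le>n. y j) \<le> suminf y" using y by (intro sum_le_suminf) auto
    also have "suminf y = exp s" by (simp add: y_def[abs_def] exp_def field_simps)
    finally show "(\<Sum>j\<le>n. y j) \<le> exp s" .
  qed (simp add: sum_nonneg y)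
  also have "(exp s)^2 = exp (2 * s)" by (simp add: exp_double)
  finally show ?thesis by (simp add: s_def)
qed

text \<open>
  In terms of successive differences the recurrence at \<open>- a\<close> has only nonnegative coefficients,
  hence its solution majorizes the oscillating solutions at \<open>x = \<plusminus> a\<close>.
\<close>

lemma laguerre_majorant:
  fixes y :: "nat \<Rightarrow> real"
  assumes rec: "\<And>n. real (n + 2) * (y (Suc (Suc n)) - y (Suc n))
      = real (n + 1) * (y (Suc n) - y n) - x * y (Suc n)"
    and y0: "\<bar>y 0\<bar> \<le> 1" and y1: "\<bar>y 1 - y 0\<bar> \<le> \<bar>x\<bar>"
  shows "\<bar>y n\<bar> \<le> laguerre_neg \<bar>x\<bar> n \<and> \<bar>y (Suc n) - y n\<bar> \<le> laguerre_neg_step \<bar>x\<bar> n"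
proof (induction n)
  case 0
  then show ?case using y0 y1 by (simp add: laguerre_neg_def laguerre_neg_step_def)
next
  case (Suc n)
  have 1: "\<bar>y (Suc n)\<bar> \<le> laguerre_neg \<bar>x\<bar> (Suc n)"
    unfolding laguerre_neg_Suc using Suc.IH by linarith
  have "real (n + 2) * \<bar>y (Suc (Suc n)) - y (Suc n)\<bar>
      = \<bar>real (n + 1) * (y (Suc n) - y n) - x * y (Suc n)\<bar>"
    unfolding rec[symmetric] by (simp only: abs_mult abs_of_nat)
  also have "\<dots> \<le> real (n + 1) * \<bar>y (Suc n) - y n\<bar> + \<bar>x\<bar> * \<bar>y (Suc n)\<bar>"
    using abs_triangle_ineq4[of "real (n + 1) * (y (Suc n) - y n)" "x * y (Suc n)"]
    by (simp only: abs_mult abs_of_nat)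
  also have "\<dots> \<le> real (n + 1) * laguerre_neg_step \<bar>x\<bar> n + \<bar>x\<bar> * laguerre_neg \<bar>x\<bar> (Suc n)"
    using Suc.IH 1 by (intro add_mono mult_left_mono) auto
  also have "\<dots> = real (n + 2) * laguerre_neg_step \<bar>x\<bar> (Suc n)"
    using laguerre_neg_step_Suc[of n "\<bar>x\<bar>"] by simp
  finally have "\<bar>y (Suc (Suc n)) - y (Suc n)\<bar> \<le> laguerre_neg_step \<bar>x\<bar> (Suc n)"
    by (rule mult_left_le_imp_le) simp
  with 1 show ?case by simp
qed

text \<open>Division by \<open>n! (-t)^n\<close> yields the Laguerre recurrence at
  \<open>x = 1/t\<close>. The hypothesis on \<open>u 1 + t * u 0\<close> becomes the bound on the
  first increment; both \<open>pade_den\<close> and \<open>pade_num\<close> give the value 1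
  there.\<close>

lemma pade_recurrence_bound:
  fixes u :: "nat \<Rightarrow> int" and t :: int
  assumes rec: "\<And>n. u (Suc (Suc n)) =
      (1 - (2 * int n + 3) * t) * u (Suc n) - (int n + 1)^2 * t^2 * u n"
    and t: "t \<noteq> 0" and u0: "\<bar>u 0\<bar> \<le> 1" and u1: "\<bar>u 1 + t * u 0\<bar> \<le> 1"
  shows "\<bar>real_of_int (u n)\<bar>
    \<le> fact n * \<bar>real_of_int t\<bar>^n * exp (2 * sqrt (real n / \<bar>real_of_int t\<bar>))"
proof -
  define s where "s = real_of_int t"
  have s: "s \<noteq> 0" using t by (simp add: s_def)
  define w where "w n = fact n * (- s)^n" for n
  have w: "w n \<noteq> 0" for n using s by (simp add: w_def)
  define y where "y n = real_of_int (u n) / w n" for n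
  have uy: "real_of_int (u n) = w n * y n" for n using w[of n] by (simp add: y_def)
  have w1: "w (Suc n) = - (real n + 1) * s * w n" for n by (simp add: w_def algebra_simps)
  have "real (n + 2) * (y (Suc (Suc n)) - y (Suc n))
      = real (n + 1) * (y (Suc n) - y n) - (1 / s) * y (Suc n)" for n
  proof -
    have "real_of_int (u (Suc (Suc n)))
      = (1 - (2 * real n + 3) * s) * real_of_int (u (Suc n))
        - (real n + 1)^2 * s^2 * real_of_int (u n)"
      unfolding rec by (simp add: s_def)
    then have "((real n + 1) * s * w n) * (s * (real (n + 2) * y (Suc (Suc n))))
      = ((real n + 1) * s * w n) *
        (s * (real (n + 1) * (y (Suc n) - y n) + real (n + 2) * y (Suc n)) - y (Suc n))"
      unfolding uy w1 by (simp add: algebra_simps power2_eq_square)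
    moreover have "(real n + 1) * s * w n \<noteq> 0" using s w[of n] by simp
    ultimately have "s * (real (n + 2) * y (Suc (Suc n)))
      = s * (real (n + 1) * (y (Suc n) - y n) + real (n + 2) * y (Suc n)) - y (Suc n)"
      by (simp only: mult_left_cancel not_False_eq_True)
    then show ?thesis using s by (simp add: field_simps)
  qed
  moreover have "\<bar>y 0\<bar> \<le> 1" using u0 by (simp add: y_def w_def)
  moreover have "\<bar>y 1 - y 0\<bar> \<le> \<bar>1 / s\<bar>"
  proof -
    have "y 1 - y 0 = - (real_of_int (u 1 + t * u 0) / s)"
      using s by (simp add: y_def w_def s_def field_simps)
    moreover have "\<bar>real_of_int (u 1 + t * u 0)\<bar> \<le> 1" using u1 by linarith
    ultimately show ?thesis by (simp add: abs_divide divide_right_mono)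
  qed
  ultimately have "\<bar>y n\<bar> \<le> laguerre_neg \<bar>1 / s\<bar> n"
    using laguerre_majorant[of y "1 / s" n] by blast
  also have "\<dots> \<le> exp (2 * sqrt (real n / \<bar>s\<bar>))"
    using laguerre_neg_le_exp[of "\<bar>1 / s\<bar>" n] by simp
  finally have "\<bar>w n\<bar> * \<bar>y n\<bar> \<le> \<bar>w n\<bar> * exp (2 * sqrt (real n / \<bar>s\<bar>))"
    by (intro mult_left_mono) auto
  then show ?thesis
    unfolding uy by (simp add: abs_mult w_def power_abs flip: s_def)
qed

section \<open>The factor \<open>B\<close> and absolute values of integers\<close>

text \<open>Of two reciprocal positive numbers, one is at least 1.\<close>

lemma B_ge_1:
  assumes "n > 0" "t \<noteq> 0"
  shows "B n t \<ge> 1"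
proof -
  define z where "z = real n * \<bar>real_of_int t\<bar> / 4"
  have z: "z > 0" using assms by (simp add: z_def)
  have "z powr (1 / 4) \<ge> 1 \<or> z powr (- 1 / 4) \<ge> 1"
  proof (cases "z \<ge> 1")
    case True
    then show ?thesis by (simp add: ge_one_powr_ge_zero)
  next
    case False
    then have "z powr (1 / 4) \<le> 1" using z by (simp add: powr_le1)
    then show ?thesis using z by (simp add: powr_minus one_le_inverse)
  qed
  moreover have "z powr (1 / 4) \<ge> 0" "z powr (- 1 / 4) \<ge> 0" by simp_all
  ultimately show ?thesis unfolding B_def z_def[symmetric] by linarith
qed

lemma padic_abs_of_int_le_1:
  assumes "prime p"
  shows "padic_abs p (of_int k) \<le> 1"
  using padic_abs_of_int[OF assms, of k] prime_ge_1_nat[OF assms] by (cases "k = 0") auto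

lemma padic_abs_dvd_le:
  assumes p: "prime p" and "k dvd m"
  shows "padic_abs p (of_int m) \<le> padic_abs p (of_int k)"
proof -
  obtain j where "m = k * j" using assms(2) by (elim dvdE)
  then show ?thesis
    using mult_left_mono[OF padic_abs_of_int_le_1[OF p, of j] padic_abs_nonneg[of p "of_int k"]]
    by (simp add: padic_abs_mult[OF p])
qed

lemma padic_abs_power: "prime p \<Longrightarrow> padic_abs p (x ^ n) = padic_abs p x ^ n"
  by (induction n) (simp_all add: padic_abs_mult)

text \<open>\<open>|k|_p\<close> is the inverse of the \<open>p\<close>-part of \<open>k\<close>, a
  divisor of \<open>k\<close> and hence at most \<open>|k|\<close>.\<close>

lemma abs_mult_padic_abs_ge_1:
  assumes p: "prime p" and k: "k \<noteq> 0"
  shows "\<bar>real_of_int k\<bar> * padic_abs p (of_int k) \<ge> 1"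
proof -
  have "int p ^ multiplicity (int p) k dvd k" by (rule multiplicity_dvd)
  then have "\<bar>int p ^ multiplicity (int p) k\<bar> \<le> \<bar>k\<bar>" using k by (intro dvd_imp_le_int)
  then have "real_of_int (int p ^ multiplicity (int p) k) \<le> real_of_int \<bar>k\<bar>"
    by (subst of_int_le_iff) simp
  then show ?thesis
    using prime_gt_0_nat[OF p] by (simp add: padic_abs_of_int[OF p k] field_simps)
qed

section \<open>The linear form in the Pade approximants\<close>

theorem theorem1p3:
  fixes p H l :: nat and c d t :: int
  assumes "prime p"
    and "d \<noteq> 0"
    and "H \<ge> 1" and "l \<ge> 1"
    and "\<bar>c\<bar> + \<bar>d\<bar> \<le> int H"
    and "t \<noteq> 0" and "padic_abs p (of_int t) < 1"
    and "real H * (2 * fact (l + 1) * B (l + 1) t)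
           * (\<bar>real_of_int t\<bar> ^ (l + 1) * exp (2 * sqrt (real (l + 1) / \<bar>real_of_int t\<bar>)))
           * padic_abs p (of_int t) ^ (2 * l) < 1"
  shows "padic_norm p
      (padic_of_int p d \<otimes>\<^bsub>padic_field p\<^esub> E_p p (padic_of_int p t)
         \<ominus>\<^bsub>padic_field p\<^esub> padic_of_int p c)
    \<ge> padic_abs p (of_int t) ^ (2 * l)"
proof (rule ccontr)
  note p = assms(1)
  define q where "q = padic_abs p (of_int t)"
  have q: "0 \<le> q" "q \<le> 1" using assms(7) by (auto simp: q_def)
  define T where "T = \<bar>real_of_int t\<bar>"
  have T: "T \<ge> 1" using assms(6) by (simp add: T_def)
  \<comment> \<open>Divisibility is used on the integers \<open>X N\<close>, the norm on their
    rational images \<open>Y N\<close>.\<close>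
  define X :: "nat \<Rightarrow> int" where "X N = (\<Sum>n<N. fact n * t ^ n)" for N
  define Y :: "nat \<Rightarrow> rat" where "Y N = (\<Sum>n<N. fact n * of_int t ^ n)" for N
  have XY: "Y N = of_int (X N)" for N by (simp add: X_def Y_def)
  have Y: "padic_cauchy p Y" "E_p p (padic_of_int p t) = padic_class p Y"
    using E_p_sums[OF p assms(7)] unfolding Y_def by blast+
  have dY: "padic_cauchy p (\<lambda>n. of_int d * Y n)"
    by (rule padic_cauchy_mult[OF p padic_cauchy_const Y(1)])
  have dYc: "padic_cauchy p (\<lambda>n. of_int d * Y n - of_int c)"
    using padic_cauchy_add[OF p dY padic_cauchy_const, of "- of_int c"] by simp
  have "padic_of_int p d \<otimes>\<^bsub>padic_field p\<^esub> E_p p (padic_of_int p t)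
      \<ominus>\<^bsub>padic_field p\<^esub> padic_of_int p c = padic_class p (\<lambda>n. of_int d * Y n - of_int c)"
    using ring_hom_mult[OF padic_class_hom[OF p], of "\<lambda>_. of_int d" Y] Y
      padic_class_minus[OF p dY padic_cauchy_const]
    by (simp add: padic_of_int_def)
  moreover assume "\<not> ?thesis"
  ultimately have "padic_norm p (padic_class p (\<lambda>n. of_int d * Y n - of_int c)) < q ^ (2 * l)"
    by (simp add: q_def)
  from order_tendstoD(2)[OF padic_norm_class[OF p dYc] this]
  have "\<forall>\<^sub>F N in sequentially. padic_abs p (of_int d * Y N - of_int c) < q ^ (2 * l)" .
  \<comment> \<open>A strict bound on the limit passes to a late partial sum;
    \<open>N >= 2 * Suc l\<close> covers the remainder for both candidates \<open>k\<close>.\<close>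
  then obtain N where N: "N \<ge> 2 * Suc l" "padic_abs p (of_int (d * X N - c)) < q ^ (2 * l)"
    by (auto simp: eventually_sequentially XY) (metis linorder_linear)

  define \<Lambda> where "\<Lambda> k = d * pade_num t k - c * pade_den t k" for k
  have "\<exists>k\<in>{l, Suc l}. \<Lambda> k \<noteq> 0"
  proof (rule ccontr)
    assume "\<not> ?thesis"
    then have 0: "\<Lambda> l = 0" "\<Lambda> (Suc l) = 0" by auto
    \<comment> \<open>This combination eliminates \<open>c\<close>, leaving \<open>d\<close> times
      the Casoratian.\<close>
    have "d * ((fact l)^2 * t^(2 * l)) = pade_den t l * \<Lambda> (Suc l) - pade_den t (Suc l) * \<Lambda> l"
      unfolding pade_casoratian[symmetric] \<Lambda>_def by (simp add: algebra_simps)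
    then show False using 0 assms(2,6) by simp
  qed
  then obtain k where k: "k \<in> {l, Suc l}" "\<Lambda> k \<noteq> 0" by blast

  have "padic_abs p (of_int (\<Lambda> k)) \<le> q ^ (2 * l)"
  proof -
    \<comment> \<open>The partial sum cancels: one summand is small by the choice of
      \<open>N\<close>, the other by the Pade remainder.\<close>
    have "\<Lambda> k = pade_den t k * (d * X N - c) + (- d) * (pade_den t k * X N - pade_num t k)"
      by (simp add: \<Lambda>_def algebra_simps)
    moreover have "padic_abs p (of_int (pade_den t k * (d * X N - c))) \<le> q ^ (2 * l)"
      using padic_abs_dvd_le[OF p dvd_triv_right[of "d * X N - c" "pade_den t k"]] N(2) by linarith
    moreover have "padic_abs p (of_int ((- d) * (pade_den t k * X N - pade_num t k))) \<le> q ^ (2 * l)"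
    proof -
      have "t^(2 * l) dvd t^(2 * k)" using k(1) by (intro le_imp_power_dvd) auto
      also have "\<dots> dvd pade_den t k * X N - pade_num t k"
        unfolding X_def using k(1) N(1) by (intro pade_remainder_dvd) auto
      finally have "t^(2 * l) dvd (- d) * (pade_den t k * X N - pade_num t k)" by (rule dvd_mult)
      from padic_abs_dvd_le[OF p this] show ?thesis
        by (simp only: of_int_power padic_abs_power[OF p] q_def)
    qed
    ultimately show ?thesis
      using padic_abs_add[OF p]
      by (metis (no_types, lifting) max.bounded_iff of_int_add order_trans)
  qed
  with abs_mult_padic_abs_ge_1[OF p k(2)]
  have 1: "1 \<le> \<bar>real_of_int (\<Lambda> k)\<bar> * q ^ (2 * l)"
    using mult_left_mono[of "padic_abs p (of_int (\<Lambda> k))" "q ^ (2 * l)" "\<bar>real_of_int (\<Lambda> k)\<bar>"]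
    by linarith

  \<comment> \<open>The bound for index \<open>l + 1\<close> also dominates index \<open>l\<close>,
    since \<open>T >= 1\<close>.\<close>
  define M where "M = fact (l + 1) * T ^ (l + 1) * exp (2 * sqrt (real (l + 1) / T))"
  have M: "fact k * T ^ k * exp (2 * sqrt (real k / T)) \<le> M"
    unfolding M_def using k(1) T
    by (intro mult_mono power_increasing fact_mono) (auto simp: divide_right_mono)
  have den: "\<bar>real_of_int (pade_den t k)\<bar> \<le> M"
    using pade_recurrence_bound[of "pade_den t" t k] assms(6) M by (simp add: T_def)
  have num: "\<bar>real_of_int (pade_num t k)\<bar> \<le> M"
    using pade_recurrence_bound[of "pade_num t" t k] assms(6) M by (simp add: T_def)
  have "\<bar>real_of_int (\<Lambda> k)\<bar> \<le> \<bar>real_of_int d\<bar> * \<bar>real_of_int (pade_num t k)\<bar>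
      + \<bar>real_of_int c\<bar> * \<bar>real_of_int (pade_den t k)\<bar>"
    unfolding \<Lambda>_def by (simp add: abs_triangle_ineq4 flip: abs_mult)
  also have "\<dots> \<le> \<bar>real_of_int d\<bar> * M + \<bar>real_of_int c\<bar> * M"
    using den num by (intro add_mono mult_left_mono) auto
  also have "\<dots> = real_of_int (\<bar>c\<bar> + \<bar>d\<bar>) * M" by (simp add: algebra_simps)
  also have "\<dots> \<le> real H * M"
    using assms(5) T by (intro mult_right_mono) (auto simp: M_def)
  \<comment> \<open>A factor of at least 1 brings the bound into the form of the hypothesis.\<close>
  also have "\<dots> \<le> real H * M * (2 * B (l + 1) t)"
    using B_ge_1[of "l + 1" t] assms(6) T
      mult_left_mono[of 1 "2 * B (l + 1) t" "real H * M"] by (simp add: M_def)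
  finally have "\<bar>real_of_int (\<Lambda> k)\<bar> * q ^ (2 * l) \<le> real H * M * (2 * B (l + 1) t) * q ^ (2 * l)"
    using q by (intro mult_right_mono) auto
  moreover have "real H * M * (2 * B (l + 1) t) * q ^ (2 * l) < 1"
    using assms(8) by (simp only: M_def q_def T_def mult_ac)
  ultimately show False using 1 by linarith
qed

end
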